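(* Let $\mathcal{H}$ be a complex Hilbert space and let $T\in\mathbb{B}(\mathcal{H})$ be accretive-dissipative. Then $$\frac{1}{\sqrt{2}}\|T\|\le \omega(T).$$
   Context: $\mathbb{B}(\mathcal{H})$ is the $C^*$-algebra of bounded linear operators on $\mathcal{H}$, with the usual operator norm $\|\cdot\|$. The numerical radius is $\omega(T)=\sup_{\|x\|=1}|\langle Tx,x\rangle|$. An operator $A\in\mathbb{B}(\mathcal{H})$ is called positive if $\langle Ax,x\rangle>0$ for all nonzero $x\in\mathcal{H}$. The real and imaginary parts of $T$ are $\Re T=\frac{T+T^*}{2}$ and $\Im T=\frac{T-T^*}{2i}$. $T$ is called accretive-dissipative if both $\Re T$ and $\Im T$ are positive. *)

theory Defs
  imports "HOL-Analysis.Analysis"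
begin

text \<open>The inner product is linear in the first argument. Completeness and the compatibility of
  the metric and topology with the norm are inherited from \<^class>\<open>banach\<close>.\<close>

class complex_hilbert_space = banach +
  fixes scaleC :: "complex \<Rightarrow> 'a \<Rightarrow> 'a" (infixr "*\<^sub>C" 75)
    and cinner :: "'a \<Rightarrow> 'a \<Rightarrow> complex"
  assumes scaleC_add_right: "c *\<^sub>C (x + y) = c *\<^sub>C x + c *\<^sub>C y"
    and scaleC_add_left: "(c + d) *\<^sub>C x = c *\<^sub>C x + d *\<^sub>C x"
    and scaleC_scaleC: "c *\<^sub>C (d *\<^sub>C x) = (c * d) *\<^sub>C x"
    and scaleC_of_real: "complex_of_real r *\<^sub>C x = r *\<^sub>R x"
    and cinner_commute: "cinner x y = cnj (cinner y x)"
    and cinner_add_left: "cinner (x + y) z = cinner x z + cinner y z"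
    and cinner_scaleC_left: "cinner (c *\<^sub>C x) y = c * cinner x y"
    and cinner_self_nonneg: "0 \<le> Re (cinner x x)"
    and cinner_self_eq_zero: "cinner x x = 0 \<longleftrightarrow> x = 0"
    and norm_eq_sqrt_cinner: "norm x = sqrt (Re (cinner x x))"

definition bounded_clinear :: "('a::complex_hilbert_space \<Rightarrow> 'a) \<Rightarrow> bool" where
  "bounded_clinear T \<longleftrightarrow> bounded_linear T \<and> (\<forall>c x. T (c *\<^sub>C x) = c *\<^sub>C T x)"

text \<open>For a bounded operator \<open>T\<close> the map described here exists (Riesz) and is unique.\<close>

definition hilbert_adjoint :: "('a::complex_hilbert_space \<Rightarrow> 'a) \<Rightarrow> 'a \<Rightarrow> 'a" where
  "hilbert_adjoint T = (THE S. \<forall>x y. cinner (T x) y = cinner x (S y))"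

definition real_part :: "('a::complex_hilbert_space \<Rightarrow> 'a) \<Rightarrow> 'a \<Rightarrow> 'a" where
  "real_part T = (\<lambda>x. (1 / 2) *\<^sub>C (T x + hilbert_adjoint T x))"

definition imag_part :: "('a::complex_hilbert_space \<Rightarrow> 'a) \<Rightarrow> 'a \<Rightarrow> 'a" where
  "imag_part T = (\<lambda>x. (1 / (2 * \<i>)) *\<^sub>C (T x - hilbert_adjoint T x))"

definition positive_operator :: "('a::complex_hilbert_space \<Rightarrow> 'a) \<Rightarrow> bool" where
  "positive_operator A \<longleftrightarrow>
    (\<forall>x. x \<noteq> 0 \<longrightarrow> cinner (A x) x \<in> \<real> \<and> 0 < Re (cinner (A x) x))"

definition accretive_dissipative :: "('a::complex_hilbert_space \<Rightarrow> 'a) \<Rightarrow> bool" where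
  "accretive_dissipative T \<longleftrightarrow>
    positive_operator (real_part T) \<and> positive_operator (imag_part T)"

text \<open>The element \<open>0\<close> only matters for the trivial space: there the unit sphere is empty and
  the supremum, taken among nonnegative reals, is \<open>0\<close>, whereas \<^term>\<open>Sup {} :: real\<close> is
  unspecified.\<close>

definition numerical_radius :: "('a::complex_hilbert_space \<Rightarrow> 'a) \<Rightarrow> real" where
  "numerical_radius T = Sup (insert 0 {cmod (cinner (T x) x) | x. norm x = 1})"

end

theory Submission
  imports Defs
begin

text \<open>Write \<open>q x = \<langle>T x, x\<rangle>\<close>; accretive-dissipativity says that \<open>Re q\<close> and \<open>Im q\<close> are nonnegative.
  Expanding \<open>Re (q (x - y)) \<ge> 0\<close> and \<open>Im (q (\<i> x - y)) \<ge> 0\<close> and adding, the terms in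
  \<open>\<langle>T y, x\<rangle>\<close> cancel and \<open>2 Re \<langle>T x, y\<rangle> \<le> Re (q x) + Im (q x) + Re (q y) + Im (q y)\<close> remains.
  Since \<open>Re z + Im z \<le> \<surd>2 \<bar>z\<bar>\<close>, the right-hand side is at most
  \<open>\<surd>2 \<omega>(T) (\<parallel>x\<parallel>\<^sup>2 + \<parallel>y\<parallel>\<^sup>2)\<close>; now let \<open>y\<close> be \<open>T x\<close> rescaled to the norm of \<open>x\<close>.\<close>

lemma cinner_add_right: "cinner x (y + z) = cinner x y + cinner x z"
  by (metis cinner_add_left cinner_commute complex_cnj_add)

lemma cinner_scaleC_right: "cinner x (c *\<^sub>C y) = cnj c * cinner x y"
  by (metis cinner_scaleC_left cinner_commute complex_cnj_mult)

lemma cinner_scaleR_left: "cinner (r *\<^sub>R x) y = of_real r * cinner x y"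
  by (metis cinner_scaleC_left scaleC_of_real)

lemma cinner_scaleR_right: "cinner x (r *\<^sub>R y) = of_real r * cinner x y"
  by (metis cinner_scaleC_right scaleC_of_real complex_cnj_complex_of_real)

lemma cinner_minus_left: "cinner (- x) y = - cinner x y"
  using cinner_scaleR_left[of "-1" x y] by simp

lemma cinner_minus_right: "cinner x (- y) = - cinner x y"
  using cinner_scaleR_right[of x "-1" y] by simp

lemma cinner_diff_left: "cinner (x - y) z = cinner x z - cinner y z"
  using cinner_add_left[of x "- y" z] by (simp add: cinner_minus_left)

lemma cinner_diff_right: "cinner x (y - z) = cinner x y - cinner x z"
  using cinner_add_right[of x y "- z"] by (simp add: cinner_minus_right)

lemma Re_cinner_self: "Re (cinner x x) = (norm x)\<^sup>2"
  by (simp add: norm_eq_sqrt_cinner cinner_self_nonneg)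

lemma norm_scaleC: "norm (c *\<^sub>C x) = cmod c * norm (x :: 'a::complex_hilbert_space)"
proof -
  have "cinner (c *\<^sub>C x) (c *\<^sub>C x) = of_real ((cmod c)\<^sup>2) * cinner x x"
    by (simp add: cinner_scaleC_left cinner_scaleC_right complex_norm_square
        mult.assoc del: of_real_power)
  then have "(norm (c *\<^sub>C x))\<^sup>2 = (cmod c * norm x)\<^sup>2"
    by (simp flip: Re_cinner_self add: power_mult_distrib del: of_real_power)
  then show ?thesis
    by (simp add: power2_eq_iff_nonneg)
qed

lemma Re_cinner_le: "2 * Re (cinner x y) \<le> (norm x)\<^sup>2 + (norm y)\<^sup>2"
proof -
  have "Re (cinner y x) = Re (cinner x y)"
    by (metis cinner_commute complex_cnj(1) cnj.simps(1))
  then show ?thesis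
    using cinner_self_nonneg[of "x - y"]
    by (simp add: cinner_diff_left cinner_diff_right Re_cinner_self)
qed

text \<open>A crude stand-in for Cauchy-Schwarz. It serves only to show that the numerical range is
  bounded, so the loss in the constant is harmless.\<close>

lemma cmod_cinner_le: "cmod (cinner x y) \<le> (norm x)\<^sup>2 + (norm y)\<^sup>2"
proof -
  have "2 * \<bar>Re (cinner x y)\<bar> \<le> (norm x)\<^sup>2 + (norm y)\<^sup>2"
    using Re_cinner_le[of x y] Re_cinner_le[of "- x" y] by (simp add: cinner_minus_left)
  moreover have "2 * \<bar>Im (cinner x y)\<bar> \<le> (norm x)\<^sup>2 + (norm y)\<^sup>2"
    \<comment> \<open>Multiplying \<open>x\<close> by \<open>\<i>\<close> or \<open>- \<i>\<close>
      keeps its norm and turns the imaginary part, up to sign, into a real part.\<close>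
    using Re_cinner_le[of "\<i> *\<^sub>C x" y] Re_cinner_le[of "(- \<i>) *\<^sub>C x" y]
    by (simp add: cinner_scaleC_left norm_scaleC)
  ultimately show ?thesis
    using cmod_le[of "cinner x y"] by linarith
qed

text \<open>Makes the \<open>Sup\<close> in \<open>numerical_radius\<close> a genuine upper bound,
  as \<open>cSup_upper\<close> requires.\<close>

lemma bdd_above_numerical_range:
  assumes "bounded_linear T"
  shows "bdd_above {cmod (cinner (T x) x) | x. norm x = 1}"
proof -
  have "cmod (cinner (T u) u) \<le> (onorm T)\<^sup>2 + 1" if "norm u = 1" for u
    using cmod_cinner_le[of "T u" u] onorm[OF assms, of u] that
      power_mono[of "norm (T u)" "onorm T" 2] by simp
  then show ?thesis
    by (auto intro!: bdd_aboveI[where M = "(onorm T)\<^sup>2 + 1"])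
qed

lemma numerical_radius_nonneg:
  assumes "bounded_linear T"
  shows "0 \<le> numerical_radius T"
  unfolding numerical_radius_def
  using bdd_above_numerical_range[OF assms] by (intro cSup_upper) auto

lemma cmod_cinner_le_numerical_radius:
  assumes "bounded_linear T"
  shows "cmod (cinner (T x) x) \<le> numerical_radius T * (norm x)\<^sup>2"
proof (cases "x = 0")
  case True
  then show ?thesis using cinner_scaleR_right[of "T 0" 0 0] by simp
next
  case False
  interpret T: bounded_linear T by fact
  define u where "u = (1 / norm x) *\<^sub>R x"
  with False have "norm u = 1"
    by simp
  then have "cmod (cinner (T u) u) \<le> numerical_radius T"
    unfolding numerical_radius_def
    using bdd_above_numerical_range[OF assms] by (intro cSup_upper) auto
  \<comment> \<open>The form is homogeneous of degree two: each slot contributes a factor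
    \<open>1 / norm x\<close>.\<close>
  moreover have "cmod (cinner (T u) u) = cmod (cinner (T x) x) / (norm x)\<^sup>2"
    by (simp add: u_def T.scaleR cinner_scaleR_left cinner_scaleR_right norm_mult norm_divide
        power2_eq_square)
  ultimately show ?thesis
    using False by (simp add: field_simps)
qed

text \<open>The adjoint drops out of the sum \<open>\<langle>(\<Re> T) x, x\<rangle> + \<i> \<langle>(\<Im> T) x, x\<rangle>\<close>,
  so its existence (Riesz) plays no role here.\<close>

lemma accretive_dissipative_cinner_nonneg:
  assumes "accretive_dissipative T"
  shows "0 \<le> Re (cinner (T x) x)" "0 \<le> Im (cinner (T x) x)"
proof -
  let ?p = "cinner (real_part T x) x" and ?q = "cinner (imag_part T x) x"
  have "cinner (T x) x = ?p + \<i> * ?q"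
    by (simp add: real_part_def imag_part_def cinner_scaleC_left cinner_add_left
        cinner_diff_left field_simps)
  moreover have "x = 0 \<or> (?p \<in> \<real> \<and> 0 < Re ?p) \<and> (?q \<in> \<real> \<and> 0 < Re ?q)"
    using assms by (auto simp: accretive_dissipative_def positive_operator_def)
  moreover have "cinner z 0 = 0" for z :: 'a
    using cinner_scaleR_right[of z 0 0] by simp
  ultimately show "0 \<le> Re (cinner (T x) x)" "0 \<le> Im (cinner (T x) x)"
    by (auto simp: complex_is_Real_iff)
qed

text \<open>Cauchy-Schwarz in the plane against the vector (1, 1), obtained from the square of
  \<open>Re z - Im z\<close>. The constant \<open>sqrt 2\<close> originates here.\<close>

lemma Re_plus_Im_le: "Re z + Im z \<le> sqrt 2 * cmod z"
proof -
  have "(Re z + Im z)\<^sup>2 \<le> 2 * ((Re z)\<^sup>2 + (Im z)\<^sup>2)"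
    using zero_le_power2[of "Re z - Im z"] by (simp add: power2_eq_square algebra_simps)
  then show ?thesis
    by (simp add: cmod_def real_le_rsqrt flip: real_sqrt_mult)
qed

lemma accretive_dissipative_Re_cinner_le:
  assumes "bounded_clinear T" and "accretive_dissipative T"
  shows "2 * Re (cinner (T x) y) \<le> sqrt 2 * numerical_radius T * ((norm x)\<^sup>2 + (norm y)\<^sup>2)"
proof -
  from assms(1) have bl: "bounded_linear T" and hom: "T (c *\<^sub>C x) = c *\<^sub>C T x" for c x
    by (auto simp: bounded_clinear_def)
  interpret T: bounded_linear T by (rule bl)
  let ?q = "\<lambda>x. cinner (T x) x"
  have "Re (cinner (T x) y) + Re (cinner (T y) x) \<le> Re (?q x) + Re (?q y)"
    using accretive_dissipative_cinner_nonneg(1)[OF assms(2), of "x - y"]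
    by (simp add: T.diff cinner_diff_left cinner_diff_right)
  \<comment> \<open>Rotating \<open>x\<close> by \<open>\<i>\<close> leaves \<open>?q x\<close>
    unchanged but multiplies the two cross terms by \<open>\<i>\<close> and \<open>- \<i>\<close>,
    so the imaginary part yields their difference instead of their sum.\<close>
  moreover have "Re (cinner (T x) y) - Re (cinner (T y) x) \<le> Im (?q x) + Im (?q y)"
    using accretive_dissipative_cinner_nonneg(2)[OF assms(2), of "\<i> *\<^sub>C x - y"]
    by (simp add: T.diff hom cinner_diff_left cinner_diff_right cinner_scaleC_left
        cinner_scaleC_right)
  moreover have "Re (?q z) + Im (?q z) \<le> sqrt 2 * (numerical_radius T * (norm z)\<^sup>2)" for z
    using Re_plus_Im_le[of "?q z"] cmod_cinner_le_numerical_radius[OF bl, of z]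
    by (meson mult_left_mono order_trans real_sqrt_ge_zero zero_le_numeral)
  from this[of x] this[of y]
  have "Re (?q x) + Im (?q x) + (Re (?q y) + Im (?q y)) \<le>
      sqrt 2 * numerical_radius T * ((norm x)\<^sup>2 + (norm y)\<^sup>2)"
    by (simp add: algebra_simps)
  ultimately show ?thesis by linarith
qed

theorem theorem2p3:
  fixes T :: "'a::complex_hilbert_space \<Rightarrow> 'a"
  assumes "bounded_clinear T"
    and "accretive_dissipative T"
  shows "1 / sqrt 2 * onorm T \<le> numerical_radius T"
proof -
  let ?M = "sqrt 2 * numerical_radius T"
  from assms(1) have bl: "bounded_linear T"
    by (simp add: bounded_clinear_def)
  interpret T: bounded_linear T by (rule bl)
  have M_nonneg: "0 \<le> ?M"
    using numerical_radius_nonneg[OF bl] by simp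
  have "norm (T x) \<le> ?M * norm x" for x
  \<comment> \<open>The witness \<open>y\<close> divides by \<open>norm (T x)\<close>, and
    \<open>norm x\<close> is cancelled at the end.\<close>
  proof (cases "x = 0 \<or> T x = 0")
    case True
    with M_nonneg show ?thesis by auto
  next
    case False
    define y where "y = (norm x / norm (T x)) *\<^sub>R T x"
    have "norm y = norm x"
      using False by (simp add: y_def)
    moreover have "Re (cinner (T x) y) = norm x * norm (T x)"
      using False by (simp add: y_def cinner_scaleR_right Re_cinner_self power2_eq_square)
    \<comment> \<open>With equal norms, the sum of squares is twice the square of
      \<open>norm x\<close>, and the factor 2 cancels.\<close>
    ultimately have "norm x * norm (T x) \<le> norm x * (?M * norm x)"
      using accretive_dissipative_Re_cinner_le[OF assms, of x y]
      by (simp add: power2_eq_square mult_ac)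
    with False show ?thesis by simp
  qed
  with M_nonneg have "onorm T \<le> ?M"
    by (rule onorm_bound)
  then show ?thesis
    by (simp add: field_simps)
qed

end
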